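(* Let $n\in\mathbb{N}$ with $n\ge 1$. The space of all $n\times n$ co-Latin matrices is equal to $V_n$.
   Context: An $n\times n$ Latin square is an $n\times n$ matrix with entries from $\{1,\dots,n\}$ such that each number in $\{1,\dots,n\}$ appears exactly once in each row and in each column. For a Latin square $L=(\ell_{p,q})_{p,q=1}^n$ and $k\in\{1,\dots,n\}$, define $L^{(-1)}(k)=\{(p,q)\in\{1,\dots,n\}^2:\ell_{p,q}=k\}$. A matrix $M=(m_{i,j})_{i,j=1}^n\in\mathbb{R}^{n\times n}$ is co-Latin if $\sum_{(p,q)\in L^{(-1)}(k)}m_{p,q}=0$ for all $k\in\{1,\dots,n\}$ and all $n\times n$ Latin squares $L$. $V_n$ is the space of matrices $M=(m_{i,j})\in\mathbb{R}^{n\times n}$ such that $m_{i,j}+m_{k,l}=m_{i,l}+m_{k,j}$ for all $i,j,k,l\in\{1,\dots,n\}$ and $\sum_{i,j=1}^n m_{i,j}=0$. *)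

theory Defs
  imports Complex_Main "Jordan_Normal_Form.Matrix"
begin

(* Row and column indices follow the matrix library and range over {0..<n};
   the symbols of a Latin square are {1..n}. *)

definition latin_square :: "nat \<Rightarrow> nat mat \<Rightarrow> bool" where
  "latin_square n L \<longleftrightarrow>
     L \<in> carrier_mat n n \<and>
     (\<forall>p<n. \<forall>q<n. L $$ (p, q) \<in> {1..n}) \<and>
     (\<forall>k\<in>{1..n}. \<forall>p<n. \<exists>!q. q < n \<and> L $$ (p, q) = k) \<and>
     (\<forall>k\<in>{1..n}. \<forall>q<n. \<exists>!p. p < n \<and> L $$ (p, q) = k)"

definition symbol_cells :: "nat \<Rightarrow> nat mat \<Rightarrow> nat \<Rightarrow> (nat \<times> nat) set" where
  "symbol_cells n L k = {(p, q). p < n \<and> q < n \<and> L $$ (p, q) = k}"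

definition co_latin :: "nat \<Rightarrow> real mat \<Rightarrow> bool" where
  "co_latin n M \<longleftrightarrow>
     M \<in> carrier_mat n n \<and>
     (\<forall>L. latin_square n L \<longrightarrow>
        (\<forall>k\<in>{1..n}. (\<Sum>(p, q)\<in>symbol_cells n L k. M $$ (p, q)) = 0))"

definition V_space :: "nat \<Rightarrow> real mat set" where
  "V_space n =
     {M \<in> carrier_mat n n.
        (\<forall>i<n. \<forall>j<n. \<forall>k<n. \<forall>l<n.
           M $$ (i, j) + M $$ (k, l) = M $$ (i, l) + M $$ (k, j)) \<and>
        (\<Sum>i<n. \<Sum>j<n. M $$ (i, j)) = 0}"

end

theory Submission
  imports Defs "HOL-Combinatorics.Permutations" "HOL-Number_Theory.Cong"
begin

text \<open>Every permutation matrix is the pattern of some symbol in a Latin square, since the rows of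
  the cyclic square may be permuted freely. Hence a matrix is co-Latin iff all its permutation sums
  vanish. Comparing two permutations that differ by a transposition gives the exchange identity
  \<open>m\<^sub>i\<^sub>j + m\<^sub>k\<^sub>l = m\<^sub>i\<^sub>l + m\<^sub>k\<^sub>j\<close>. Conversely, under the exchange identity each permutation sum
  is the sum of all entries divided by \<open>n\<close>.\<close>

lemma inj_on_card_eq_ex1:
  assumes "inj_on g A" "g ` A \<subseteq> B" "finite B" "card A = card B" "k \<in> B"
  shows "\<exists>!x. x \<in> A \<and> g x = k"
proof -
  have "g ` A = B"
    using assms by (intro card_subset_eq) (auto simp: card_image)
  with assms show ?thesis
    by (auto dest: inj_onD)
qed

text \<open>By pigeonhole, \<open>n\<close> distinct entries drawn from \<open>{1..n}\<close> hit
  each symbol exactly once, so only distinctness along rows and columns has to be checked.\<close>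

lemma latin_squareI:
  assumes "L \<in> carrier_mat n n"
    and entries: "\<And>p q. p < n \<Longrightarrow> q < n \<Longrightarrow> L $$ (p, q) \<in> {1..n}"
    and rows: "\<And>p. p < n \<Longrightarrow> inj_on (\<lambda>q. L $$ (p, q)) {..<n}"
    and cols: "\<And>q. q < n \<Longrightarrow> inj_on (\<lambda>p. L $$ (p, q)) {..<n}"
  shows "latin_square n L"
proof -
  have "\<exists>!q. q \<in> {..<n} \<and> L $$ (p, q) = k" if "k \<in> {1..n}" "p < n" for k p
    using that entries by (intro inj_on_card_eq_ex1[OF rows, of _ "{1..n}"]) auto
  moreover have "\<exists>!p. p \<in> {..<n} \<and> L $$ (p, q) = k" if "k \<in> {1..n}" "q < n" for k q
    using that entries by (intro inj_on_card_eq_ex1[OF cols, of _ "{1..n}"]) auto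
  ultimately show ?thesis
    using assms(1) entries by (simp add: latin_square_def)
qed

lemma add_mod_inj_nat:
  fixes a b c n :: nat
  assumes "(a + c) mod n = (b + c) mod n" "a < n" "b < n"
  shows "a = b"
  using assms cong_add_rcancel_nat[of a c b n] by (simp add: cong_def)

lemma sum_graph:
  "(\<Sum>(p, q)\<in>{(p, q). p \<in> A \<and> q = f p}. h p q) = (\<Sum>p\<in>A. h p (f p))"
proof -
  have "{(p, q). p \<in> A \<and> q = f p} = (\<lambda>p. (p, f p)) ` A"
    by auto
  then show ?thesis
    by (simp add: sum.reindex inj_on_def)
qed

text \<open>Uniqueness in rows makes the cells of a symbol the graph of a function; uniqueness in
  columns makes that function injective, hence bijective on the finite set
  \<open>{..<n}\<close>.\<close>

lemma latin_square_symbol_cells_graph: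
  assumes "latin_square n L" "k \<in> {1..n}"
  obtains f where "bij_betw f {..<n} {..<n}"
    and "symbol_cells n L k = {(p, q). p \<in> {..<n} \<and> q = f p}"
proof -
  have row: "\<exists>!q. q < n \<and> L $$ (p, q) = k" if "p < n" for p
    using assms that by (simp add: latin_square_def)
  have col: "\<exists>!p. p < n \<and> L $$ (p, q) = k" if "q < n" for q
    using assms that by (simp add: latin_square_def)
  define f where "f p = (THE q. q < n \<and> L $$ (p, q) = k)" for p
  have f: "f p < n \<and> L $$ (p, f p) = k" if "p < n" for p
    unfolding f_def by (rule theI'[OF row[OF that]])
  have "inj_on f {..<n}"
    using col f by (auto simp: inj_on_def) metis
  moreover have "f ` {..<n} \<subseteq> {..<n}"
    using f by auto
  ultimately have "bij_betw f {..<n} {..<n}"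
    by (simp add: bij_betw_def endo_inj_surj)
  moreover have "symbol_cells n L k = {(p, q). p \<in> {..<n} \<and> q = f p}"
    using row f by (auto simp: symbol_cells_def)
  ultimately show thesis ..
qed

lemma permutation_is_symbol_pattern:
  assumes f: "bij_betw f {..<n} {..<n}"
  obtains L where "latin_square n L"
    and "symbol_cells n L n = {(p, q). p \<in> {..<n} \<and> q = f p}"
proof -
  \<comment> \<open>Row \<open>p\<close> is the cyclic row shifted by \<open>n - 1 - f p\<close>, so
    that column \<open>f p\<close> receives the largest residue \<open>n - 1\<close>; adding 1 moves
    the residues to \<open>{1..n}\<close> and turns this one into \<open>n\<close>.\<close>
  define L where "L = mat n n (\<lambda>(p, q). (q + (n - 1 - f p)) mod n + 1)"
  have fn: "f p < n" if "p < n" for p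
    using f that by (auto simp: bij_betw_def)
  have entry: "L $$ (p, q) = (q + (n - 1 - f p)) mod n + 1" if "p < n" "q < n" for p q
    using that by (simp add: L_def)
  have row: "q = q'" if "p < n" "q < n" "q' < n" "L $$ (p, q) = L $$ (p, q')" for p q q'
    using that add_mod_inj_nat[of q _ n q'] by (simp add: entry)
  have col: "p = p'" if "p < n" "p' < n" "q < n" "L $$ (p, q) = L $$ (p', q)" for p p' q
  proof -
    \<comment> \<open>Both shifts are below \<open>n\<close>, so cancelling \<open>q\<close> modulo
      \<open>n\<close> gives equality. The subtraction never truncates, since
      \<open>f p < n\<close>, so the shift determines \<open>f p\<close>.\<close>
    have "n - 1 - f p = n - 1 - f p'"
      using that add_mod_inj_nat[of "n - 1 - f p" q n "n - 1 - f p'"]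
      by (simp add: entry add.commute)
    with fn[of p] fn[of p'] that have "f p = f p'"
      by linarith
    with f that show ?thesis
      by (auto simp: bij_betw_def dest: inj_onD)
  qed
  have "latin_square n L"
  proof (rule latin_squareI)
    show "L \<in> carrier_mat n n"
      by (simp add: L_def)
    show "L $$ (p, q) \<in> {1..n}" if "p < n" "q < n" for p q
    proof -
      have "(q + (n - 1 - f p)) mod n < n"
        using that by simp
      then show ?thesis
        by (simp add: entry that)
    qed
    show "inj_on (\<lambda>q. L $$ (p, q)) {..<n}" if "p < n" for p
      using row[OF that] by (simp add: inj_on_def)
    show "inj_on (\<lambda>p. L $$ (p, q)) {..<n}" if "q < n" for q
      using col[OF _ _ that] by (simp add: inj_on_def)
  qed
  moreover have diag: "L $$ (p, f p) = n" if "p < n" for p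
    using fn[OF that] that by (simp add: entry)
  have "symbol_cells n L n = {(p, q). p \<in> {..<n} \<and> q = f p}"
    using row[OF _ _ fn] diag fn by (fastforce simp: symbol_cells_def)
  ultimately show thesis ..
qed

text \<open>Forward, the symbol \<open>n\<close> alone already realises every permutation;
  \<open>n \<ge> 1\<close> makes it a legitimate symbol.\<close>

lemma co_latin_iff_permutation_sums:
  assumes "n \<ge> 1"
  shows "co_latin n M \<longleftrightarrow> M \<in> carrier_mat n n \<and>
    (\<forall>f. bij_betw f {..<n} {..<n} \<longrightarrow> (\<Sum>p<n. M $$ (p, f p)) = 0)"
proof
  assume M: "co_latin n M"
  have "(\<Sum>p<n. M $$ (p, f p)) = 0" if f: "bij_betw f {..<n} {..<n}" for f
  proof -
    obtain L where "latin_square n L"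
      and "symbol_cells n L n = {(p, q). p \<in> {..<n} \<and> q = f p}"
      using permutation_is_symbol_pattern[OF f] .
    moreover from this have "(\<Sum>(p, q)\<in>symbol_cells n L n. M $$ (p, q)) = 0"
      using M assms atLeastAtMost_iff unfolding co_latin_def by blast
    ultimately show ?thesis
      by (simp only: sum_graph)
  qed
  with M show "M \<in> carrier_mat n n \<and>
    (\<forall>f. bij_betw f {..<n} {..<n} \<longrightarrow> (\<Sum>p<n. M $$ (p, f p)) = 0)"
    by (simp add: co_latin_def)
next
  assume M: "M \<in> carrier_mat n n \<and>
    (\<forall>f. bij_betw f {..<n} {..<n} \<longrightarrow> (\<Sum>p<n. M $$ (p, f p)) = 0)"
  have "(\<Sum>(p, q)\<in>symbol_cells n L k. M $$ (p, q)) = 0"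
    if L: "latin_square n L" "k \<in> {1..n}" for L k
  proof -
    obtain f where "bij_betw f {..<n} {..<n}"
      and "symbol_cells n L k = {(p, q). p \<in> {..<n} \<and> q = f p}"
      using latin_square_symbol_cells_graph[OF L] .
    with M show ?thesis
      by (simp only: sum_graph)
  qed
  with M show "co_latin n M"
    unfolding co_latin_def by blast
qed

text \<open>Double counting: add up the exchange identity for the cells \<open>(p, f p)\<close> and
  \<open>(q, f q)\<close> over all pairs \<open>p\<close>, \<open>q\<close>. The left side yields
  the permutation sum \<open>2 * card A\<close> times; on the right each of the two terms yields the
  total, after reindexing along \<open>f\<close>.\<close>

lemma permutation_sum_of_exchange:
  fixes m :: "'a \<Rightarrow> 'a \<Rightarrow> real"
  assumes f: "bij_betw f A A"
    and exch: "\<And>i j k l. i \<in> A \<Longrightarrow> j \<in> A \<Longrightarrow> k \<in> A \<Longrightarrow> l \<in> A \<Longrightarrow> m i j + m k l = m i l + m k j"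
  shows "real (card A) * (\<Sum>p\<in>A. m p (f p)) = (\<Sum>p\<in>A. \<Sum>q\<in>A. m p q)"
proof -
  let ?D = "\<Sum>p\<in>A. m p (f p)"
  have fA: "f p \<in> A" if "p \<in> A" for p
    using f that by (auto simp: bij_betw_def)
  have reindex: "(\<Sum>q\<in>A. m p (f q)) = (\<Sum>q\<in>A. m p q)" for p
    using sum.reindex_bij_betw[OF f] .
  have "(\<Sum>p\<in>A. \<Sum>q\<in>A. m p (f p) + m q (f q)) = (\<Sum>p\<in>A. \<Sum>q\<in>A. m p (f q) + m q (f p))"
    by (intro sum.cong refl exch fA)
  moreover have "(\<Sum>p\<in>A. \<Sum>q\<in>A. m p (f p) + m q (f q)) = 2 * (real (card A) * ?D)"
    by (simp add: sum.distrib sum_distrib_left)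
  moreover have "(\<Sum>p\<in>A. \<Sum>q\<in>A. m q (f p)) = (\<Sum>p\<in>A. \<Sum>q\<in>A. m p (f q))"
    by (rule sum.swap)
  then have "(\<Sum>p\<in>A. \<Sum>q\<in>A. m p (f q) + m q (f p)) = 2 * (\<Sum>p\<in>A. \<Sum>q\<in>A. m p q)"
    by (simp add: sum.distrib reindex)
  ultimately show ?thesis
    by simp
qed

lemma exchange_of_permutation_sums:
  fixes m :: "'a \<Rightarrow> 'a \<Rightarrow> real"
  assumes "finite A"
    and sums: "\<And>f. bij_betw f A A \<Longrightarrow> (\<Sum>p\<in>A. m p (f p)) = 0"
    and A: "i \<in> A" "j \<in> A" "k \<in> A" "l \<in> A"
  shows "m i j + m k l = m i l + m k j"
proof (cases "i = k \<or> j = l")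
  \<comment> \<open>If \<open>i = k\<close> or \<open>j = l\<close>, both sides consist of the same
    two terms, so only distinct rows and columns need an argument.\<close>
  case False
  then have ne: "i \<noteq> k" "j \<noteq> l"
    by auto
  \<comment> \<open>The inner swap sends \<open>i\<close> to \<open>j\<close> and \<open>k\<close>
    to \<open>transpose i j k\<close>, which differs from \<open>j\<close> because
    \<open>k \<noteq> i\<close>. The outer swap then moves that value to \<open>l\<close> and leaves
    \<open>j\<close> alone. Composing with \<open>transpose i k\<close> exchanges the two
    images.\<close>
  define f where "f = transpose l (transpose i j k) \<circ> transpose i j"
  define g where "g = f \<circ> transpose i k"
  have "transpose i j k \<in> A"
    using A by (simp add: transpose_def)
  then have f: "f permutes A"
    using A unfolding f_def by (intro permutes_compose permutes_swap_id)
  then have g: "g permutes A"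
    using A unfolding g_def by (intro permutes_compose permutes_swap_id)
  have fg: "f i = j" "f k = l" "g i = l" "g k = j"
    using ne by (auto simp: f_def g_def transpose_def)
  have "(\<Sum>p\<in>A. m p (f p)) = m i j + m k l + (\<Sum>p\<in>A - {i} - {k}. m p (f p))"
    using A ne \<open>finite A\<close> by (simp add: sum.remove[of A i] sum.remove[of "A - {i}" k] fg)
  moreover have "(\<Sum>p\<in>A. m p (g p)) = m i l + m k j + (\<Sum>p\<in>A - {i} - {k}. m p (g p))"
    using A ne \<open>finite A\<close> by (simp add: sum.remove[of A i] sum.remove[of "A - {i}" k] fg)
  \<comment> \<open>\<open>transpose i k\<close> fixes every other point, so the remaining terms
    cancel when the two vanishing sums are compared.\<close>
  moreover have "(\<Sum>p\<in>A - {i} - {k}. m p (g p)) = (\<Sum>p\<in>A - {i} - {k}. m p (f p))"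
    by (intro sum.cong) (auto simp: g_def transpose_def)
  ultimately show ?thesis
    using sums[OF permutes_imp_bij[OF f]] sums[OF permutes_imp_bij[OF g]] by linarith
qed auto

theorem theorem5p1:
  fixes n :: nat
  assumes "n \<ge> 1"
  shows "{M :: real mat. co_latin n M} = V_space n"
proof (intro subset_antisym subsetI)
  fix M :: "real mat"
  assume "M \<in> {M. co_latin n M}"
  then have carrier: "M \<in> carrier_mat n n"
    and sums: "\<And>f. bij_betw f {..<n} {..<n} \<Longrightarrow> (\<Sum>p<n. M $$ (p, f p)) = 0"
    using assms by (auto simp: co_latin_iff_permutation_sums)
  have exch: "M $$ (i, j) + M $$ (k, l) = M $$ (i, l) + M $$ (k, j)"
    if "i \<in> {..<n}" "j \<in> {..<n}" "k \<in> {..<n}" "l \<in> {..<n}" for i j k l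
    using exchange_of_permutation_sums[of "{..<n}" "\<lambda>p q. M $$ (p, q)"] sums that by simp
  \<comment> \<open>One permutation suffices for the total: it is \<open>n\<close> times the
    diagonal sum, which vanishes.\<close>
  have id: "bij_betw id {..<n} {..<n}"
    by simp
  have "(\<Sum>p<n. \<Sum>q<n. M $$ (p, q)) = 0"
    using permutation_sum_of_exchange[of id "{..<n}" "\<lambda>p q. M $$ (p, q)", OF id exch] sums[OF id]
    by simp
  with carrier exch show "M \<in> V_space n"
    by (simp add: V_space_def)
next
  fix M :: "real mat"
  assume "M \<in> V_space n"
  then have carrier: "M \<in> carrier_mat n n"
    and exch: "\<And>i j k l. i \<in> {..<n} \<Longrightarrow> j \<in> {..<n} \<Longrightarrow> k \<in> {..<n} \<Longrightarrow> l \<in> {..<n} \<Longrightarrow>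
      M $$ (i, j) + M $$ (k, l) = M $$ (i, l) + M $$ (k, j)"
    and total: "(\<Sum>i<n. \<Sum>j<n. M $$ (i, j)) = 0"
    unfolding V_space_def by blast+
  \<comment> \<open>Here \<open>n\<close> times the permutation sum equals the total 0, and
    \<open>n \<ge> 1\<close> allows the factor to be cancelled.\<close>
  have "(\<Sum>p<n. M $$ (p, f p)) = 0" if f: "bij_betw f {..<n} {..<n}" for f
    using permutation_sum_of_exchange[of f "{..<n}" "\<lambda>p q. M $$ (p, q)", OF f exch] total assms
    by simp
  with carrier show "M \<in> {M. co_latin n M}"
    using assms by (simp add: co_latin_iff_permutation_sums)
qed

end
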